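(* Let $\{g_s : 1\le s\le M\}$ be a finite set in $\mathbb{C}^N$ and let $\alpha,\beta>0$. Then the family $\{T_i g_s : 1\le i\le N,\ 1\le s\le M\}$ is a frame for $\mathbb{C}^N$ with frame bounds $\alpha$ and $\beta$ if and only if $$\frac{\alpha}{N}\le \sum_{s=1}^M |\widehat{g_s}(\lambda_l)|^2\le \frac{\beta}{N}\quad\text{for all } l\in\{1,\dots,N\}.$$
   Context: Let $G$ be an undirected, connected, weighted graph with vertex set $\mathcal V=\{1,\dots,N\}$, and let $A$ be an $N\times N$ diagonalizable matrix associated with $G$ (for example its adjacency matrix or its graph Laplacian), with eigenvalues $\lambda_1,\dots,\lambda_N$ (listed with multiplicity) and corresponding eigenvectors $\chi_1,\dots,\chi_N$ forming an orthonormal basis of $\mathbb{C}^N$. A signal $f:\mathcal V\to\mathbb{C}$ is identified with the vector $(f(1),\dots,f(N))\in\mathbb{C}^N$. The graph Fourier transform of $f\in\mathbb{C}^N$ is $\widehat f(\lambda_l)=\sum_{n=1}^N f(n)\overline{\chi_l(n)}$, $l=1,\dots,N$ (indexed by $l$). The generalized convolution is $(f\ast g)(n)=\sum_{l=1}^N \widehat f(\lambda_l)\widehat g(\lambda_l)\chi_l(n)$. For $i=1,\dots,N$, $\delta_i\in\mathbb{C}^N$ is given by $\delta_i(n)=1$ if $n=i$ and $0$ otherwise, and the generalized translation is $T_i f=\sqrt N\,(f\ast\delta_i)$. A (finite, indexed) family $\{f_k\}$ in $\mathbb{C}^N$ is a frame for $\mathbb{C}^N$ with frame bounds $\alpha,\beta>0$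 if $\alpha\|f\|^2\le\sum_k|\langle f,f_k\rangle|^2\le\beta\|f\|^2$ for all $f\in\mathbb{C}^N$. *)

theory Defs
  imports "HOL-Analysis.Analysis"
begin

text \<open>
  The vertex set \<open>{1,\<dots>,N}\<close> is rendered by a finite type \<open>'n\<close> with \<open>N = CARD('n)\<close>; the same type
  indexes the eigenpairs. Signals are vectors of type \<open>complex ^ 'n\<close>, whose library norm is the
  usual Euclidean one.
\<close>

text \<open>An undirected weighted graph is given by its symmetric weight function: vertices
  are adjacent iff their weight is nonzero. Loops and negative weights are allowed.\<close>

definition connected_weighted_graph :: "('n::finite \<Rightarrow> 'n \<Rightarrow> real) \<Rightarrow> bool" where
  "connected_weighted_graph W \<longleftrightarrow>
     (\<forall>i j. W i j = W j i) \<and> (\<forall>i j. (i, j) \<in> {(a, b). W a b \<noteq> 0}\<^sup>*)"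

text \<open>The library's \<open>\<bullet>\<close> on \<open>complex ^ 'n\<close> is real-valued, hence the Hermitian product is
  defined here; it is linear in the first argument.\<close>

definition cdot :: "complex ^ 'n::finite \<Rightarrow> complex ^ 'n \<Rightarrow> complex" where
  "cdot f g = (\<Sum>n\<in>UNIV. f $ n * cnj (g $ n))"

definition orthonormal_basis :: "('n::finite \<Rightarrow> complex ^ 'n) \<Rightarrow> bool" where
  "orthonormal_basis b \<longleftrightarrow>
     (\<forall>k l. cdot (b k) (b l) = (if k = l then 1 else 0)) \<and> vec.span (range b) = UNIV"

text \<open>Existence of such \<open>lam\<close> and \<open>b\<close> makes \<open>A\<close> diagonalizable, and \<open>lam\<close> then lists its
  eigenvalues with multiplicity.\<close>

definition orthonormal_eigenbasis ::
  "complex ^ 'n ^ 'n::finite \<Rightarrow> ('n \<Rightarrow> complex) \<Rightarrow> ('n \<Rightarrow> complex ^ 'n) \<Rightarrow> bool" where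
  "orthonormal_eigenbasis A lam b \<longleftrightarrow>
     orthonormal_basis b \<and> (\<forall>l. A *v b l = lam l *s b l)"

text \<open>The graph Fourier transform at the \<open>l\<close>-th eigenvalue. It is a function of the index \<open>l\<close>, not
  of the number \<open>lam l\<close>: a repeated eigenvalue has several coefficients.\<close>

definition gft :: "('n::finite \<Rightarrow> complex ^ 'n) \<Rightarrow> complex ^ 'n \<Rightarrow> 'n \<Rightarrow> complex" where
  "gft b f l = (\<Sum>n\<in>UNIV. f $ n * cnj (b l $ n))"

definition gconv ::
  "('n::finite \<Rightarrow> complex ^ 'n) \<Rightarrow> complex ^ 'n \<Rightarrow> complex ^ 'n \<Rightarrow> complex ^ 'n" where
  "gconv b f g = (\<chi> n. \<Sum>l\<in>UNIV. gft b f l * gft b g l * b l $ n)"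

text \<open>\<open>axis i 1\<close> is the unit impulse at vertex \<open>i\<close>.\<close>

definition gtrans ::
  "('n::finite \<Rightarrow> complex ^ 'n) \<Rightarrow> 'n \<Rightarrow> complex ^ 'n \<Rightarrow> complex ^ 'n" where
  "gtrans b i f = sqrt (real CARD('n)) *\<^sub>R gconv b f (axis i 1)"

definition is_frame ::
  "'k set \<Rightarrow> ('k \<Rightarrow> complex ^ 'n::finite) \<Rightarrow> real \<Rightarrow> real \<Rightarrow> bool" where
  "is_frame K F \<alpha> \<beta> \<longleftrightarrow>
     finite K \<and> 0 < \<alpha> \<and> 0 < \<beta> \<and>
     (\<forall>f. \<alpha> * (norm f)\<^sup>2 \<le> (\<Sum>k\<in>K. (cmod (cdot f (F k)))\<^sup>2) \<and>
          (\<Sum>k\<in>K. (cmod (cdot f (F k)))\<^sup>2) \<le> \<beta> * (norm f)\<^sup>2)"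

end

theory Submission
  imports Defs
begin

text \<open>
  The inner products of \<open>f\<close> with the translates \<open>T\<^sub>i g\<close> are, up to the factor \<open>\<surd>N\<close>, the values at \<open>i\<close>
  of the signal whose Fourier coefficients are those of \<open>f\<close> times the conjugates of those of \<open>g\<close>.
  By Parseval the frame operator is thus a Fourier multiplier: the frame sum equals
  \<open>N \<Sum>\<^sub>l |gft f l|\<^sup>2 G l\<close> with \<open>G l = \<Sum>\<^sub>s |gft g\<^sub>s l|\<^sup>2\<close>. Bounds on \<open>G\<close> give the frame
  bounds, and conversely testing the frame inequality on the \<open>l\<close>-th eigenvector gives the bounds on \<open>G l\<close>.
\<close>

lemma norm_power2_vec:
  fixes f :: "complex ^ 'n::finite"
  shows "(norm f)\<^sup>2 = (\<Sum>i\<in>UNIV. (cmod (f $ i))\<^sup>2)"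
  by (simp add: norm_vec_def L2_set_def sum_nonneg)

lemma gft_eq_cdot: "gft b f l = cdot f (b l)"
  by (simp add: gft_def cdot_def)

lemma gft_axis: "gft b (axis i 1) l = cnj (b l $ i)"
proof -
  have "gft b (axis i 1) l = (\<Sum>n\<in>UNIV. if n = i then cnj (b l $ n) else 0)"
    unfolding gft_def by (rule sum.cong) (auto simp: axis_def)
  then show ?thesis by simp
qed

text \<open>Expanding the squared modulus gives a double sum over \<open>l\<close> and
  \<open>k\<close>, and orthonormality removes the cross terms. The coefficients \<open>c\<close>
  are arbitrary so that the identity serves both for Parseval and for the products of coefficients
  arising from translates.\<close>

lemma sum_cmod_power2_synthesis:
  fixes b :: "'n::finite \<Rightarrow> complex ^ 'n"
  assumes "orthonormal_basis b"
  shows "(\<Sum>i\<in>UNIV. (cmod (\<Sum>l\<in>UNIV. c l * b l $ i))\<^sup>2) = (\<Sum>l\<in>UNIV. (cmod (c l))\<^sup>2)"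
proof -
  have orth: "(\<Sum>i\<in>UNIV. b l $ i * cnj (b k $ i)) = (if l = k then 1 else 0)" for k l
    using assms by (simp add: orthonormal_basis_def cdot_def)
  \<comment> \<open>The computation is moved into the complex numbers, where a squared modulus is
    \<open>z * cnj z\<close> and the product of sums can be expanded.\<close>
  have "complex_of_real (\<Sum>i\<in>UNIV. (cmod (\<Sum>l\<in>UNIV. c l * b l $ i))\<^sup>2)
      = (\<Sum>i\<in>UNIV. \<Sum>l\<in>UNIV. \<Sum>k\<in>UNIV. c l * cnj (c k) * (b l $ i * cnj (b k $ i)))"
    by (simp add: complex_norm_square sum_product mult_ac del: of_real_power)
  also have "\<dots> = (\<Sum>l\<in>UNIV. \<Sum>i\<in>UNIV. \<Sum>k\<in>UNIV. c l * cnj (c k) * (b l $ i * cnj (b k $ i)))"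
    by (rule sum.swap)
  also have "\<dots> = (\<Sum>l\<in>UNIV. \<Sum>k\<in>UNIV. \<Sum>i\<in>UNIV. c l * cnj (c k) * (b l $ i * cnj (b k $ i)))"
    by (rule sum.cong[OF refl], rule sum.swap)
  also have "\<dots> = (\<Sum>l\<in>UNIV. \<Sum>k\<in>UNIV. if l = k then c l * cnj (c k) else 0)"
    by (intro sum.cong refl) (simp add: sum_distrib_left[symmetric] orth)
  also have "\<dots> = complex_of_real (\<Sum>l\<in>UNIV. (cmod (c l))\<^sup>2)"
    by (simp add: complex_norm_square del: of_real_power)
  finally show ?thesis
    by (simp only: of_real_eq_iff)
qed

text \<open>The expansion is linear in \<open>f\<close> and reproduces each basis vector, so
  induction over the span of the basis extends it to every signal.\<close>

lemma gft_inversion: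
  fixes b :: "'n::finite \<Rightarrow> complex ^ 'n"
  assumes "orthonormal_basis b"
  shows "f = (\<Sum>l\<in>UNIV. gft b f l *s b l)"
proof -
  have "f \<in> vec.span (range b)"
    using assms by (simp add: orthonormal_basis_def)
  then show ?thesis
  proof (induction rule: vec.span_induct_alt)
    case base
    show ?case by (simp add: gft_def)
  next
    case (step c x y)
    then obtain k where k: "x = b k" by auto
    \<comment> \<open>By orthonormality, adding a multiple of \<open>b k\<close> changes only the
      \<open>k\<close>-th coefficient.\<close>
    have "gft b (c *s x + y) l = (if l = k then c else 0) + gft b y l" for l
    proof -
      have "gft b (c *s x + y) l = c * cdot (b k) (b l) + gft b y l"
        by (simp add: k gft_def cdot_def algebra_simps sum.distrib sum_distrib_left)
      then show ?thesis
        using assms by (auto simp: orthonormal_basis_def)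
    qed
    then have "(\<Sum>l\<in>UNIV. gft b (c *s x + y) l *s b l)
        = (\<Sum>l\<in>UNIV. (if l = k then c *s b l else 0) + gft b y l *s b l)"
      by (intro sum.cong) auto
    also have "\<dots> = c *s x + (\<Sum>l\<in>UNIV. gft b y l *s b l)"
      by (simp add: sum.distrib k)
    finally show ?case
      using step by simp
  qed
qed

lemma gft_parseval:
  fixes b :: "'n::finite \<Rightarrow> complex ^ 'n"
  assumes "orthonormal_basis b"
  shows "(norm f)\<^sup>2 = (\<Sum>l\<in>UNIV. (cmod (gft b f l))\<^sup>2)"
proof -
  have "f $ i = (\<Sum>l\<in>UNIV. gft b f l * b l $ i)" for i
    using arg_cong[OF gft_inversion[OF assms, of f], of "\<lambda>v. v $ i"] by simp
  then have "(norm f)\<^sup>2 = (\<Sum>i\<in>UNIV. (cmod (\<Sum>l\<in>UNIV. gft b f l * b l $ i))\<^sup>2)"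
    by (simp add: norm_power2_vec)
  then show ?thesis
    using sum_cmod_power2_synthesis[OF assms] by simp
qed

text \<open>The impulse at \<open>i\<close> has coefficients \<open>cnj (b l $ i)\<close>. The
  conjugation in the second slot of \<open>cdot\<close> turns them into \<open>b l $ i\<close>, so
  that, as a function of \<open>i\<close>, the result is again a combination of the basis
  vectors.\<close>

lemma cdot_gtrans:
  fixes b :: "'n::finite \<Rightarrow> complex ^ 'n"
  shows "cdot f (gtrans b i g)
    = sqrt (real CARD('n)) * (\<Sum>l\<in>UNIV. gft b f l * cnj (gft b g l) * b l $ i)"
proof -
  have "gtrans b i g $ n =
      sqrt (real CARD('n)) * (\<Sum>l\<in>UNIV. gft b g l * cnj (b l $ i) * b l $ n)" for n
    by (simp add: gtrans_def gconv_def gft_axis) (simp add: scaleR_conv_of_real)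
  then have "cdot f (gtrans b i g) = sqrt (real CARD('n)) *
      (\<Sum>n\<in>UNIV. \<Sum>l\<in>UNIV. f $ n * cnj (b l $ n) * (cnj (gft b g l) * b l $ i))"
    by (simp add: cdot_def sum_distrib_left mult_ac)
  also have "\<dots> = sqrt (real CARD('n)) *
      (\<Sum>l\<in>UNIV. \<Sum>n\<in>UNIV. f $ n * cnj (b l $ n) * (cnj (gft b g l) * b l $ i))"
    by (subst sum.swap) simp
  also have "\<dots> = sqrt (real CARD('n)) * (\<Sum>l\<in>UNIV. gft b f l * cnj (gft b g l) * b l $ i)"
    by (simp add: gft_def[of b f] sum_distrib_right mult.assoc)
  finally show ?thesis .
qed

text \<open>This is the synthesis identity with \<open>c l = gft b f l * cnj (gft b g l)\<close>;
  the factor \<open>CARD('n)\<close> is the square of the normalization of the translation.\<close>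

lemma sum_cmod_cdot_gtrans:
  fixes b :: "'n::finite \<Rightarrow> complex ^ 'n"
  assumes "orthonormal_basis b"
  shows "(\<Sum>i\<in>UNIV. (cmod (cdot f (gtrans b i g)))\<^sup>2)
    = real CARD('n) * (\<Sum>l\<in>UNIV. (cmod (gft b f l))\<^sup>2 * (cmod (gft b g l))\<^sup>2)"
  by (simp add: cdot_gtrans norm_mult power_mult_distrib sum_distrib_left[symmetric]
      sum_cmod_power2_synthesis[OF assms])

lemma frame_sum_gtrans:
  fixes b :: "'n::finite \<Rightarrow> complex ^ 'n"
  assumes "orthonormal_basis b"
  shows "(\<Sum>(i, s)\<in>UNIV \<times> S. (cmod (cdot f (gtrans b i (g s))))\<^sup>2)
    = (\<Sum>l\<in>UNIV. (cmod (gft b f l))\<^sup>2 * (real CARD('n) * (\<Sum>s\<in>S. (cmod (gft b (g s) l))\<^sup>2)))"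
proof -
  \<comment> \<open>Summing over the vertices first makes the single-generator identity applicable
    for each \<open>s\<close>.\<close>
  have "(\<Sum>(i, s)\<in>UNIV \<times> S. (cmod (cdot f (gtrans b i (g s))))\<^sup>2)
      = (\<Sum>s\<in>S. \<Sum>i\<in>UNIV. (cmod (cdot f (gtrans b i (g s))))\<^sup>2)"
    by (subst sum.cartesian_product[symmetric]) (rule sum.swap)
  also have "\<dots> = (\<Sum>s\<in>S. \<Sum>l\<in>UNIV. (cmod (gft b f l))\<^sup>2 * (real CARD('n) * (cmod (gft b (g s) l))\<^sup>2))"
    by (simp add: sum_cmod_cdot_gtrans[OF assms] sum_distrib_left mult_ac)
  also have "\<dots> = (\<Sum>l\<in>UNIV. \<Sum>s\<in>S. (cmod (gft b f l))\<^sup>2 * (real CARD('n) * (cmod (gft b (g s) l))\<^sup>2))"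
    by (rule sum.swap)
  finally show ?thesis
    by (simp add: sum_distrib_left)
qed

lemma multiplier_bounds_iff:
  fixes b :: "'n::finite \<Rightarrow> complex ^ 'n" and G :: "'n \<Rightarrow> real"
  assumes "orthonormal_basis b"
  shows "(\<forall>f. \<alpha> * (norm f)\<^sup>2 \<le> (\<Sum>l\<in>UNIV. (cmod (gft b f l))\<^sup>2 * G l) \<and>
              (\<Sum>l\<in>UNIV. (cmod (gft b f l))\<^sup>2 * G l) \<le> \<beta> * (norm f)\<^sup>2)
    \<longleftrightarrow> (\<forall>l. \<alpha> \<le> G l \<and> G l \<le> \<beta>)"
    (is "?L \<longleftrightarrow> ?R")
proof
  assume L: ?L
  show ?R
  proof
    fix k
    have coeff: "(cmod (gft b (b k) l))\<^sup>2 = (if l = k then 1 else 0)" for l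
      using assms by (auto simp: gft_eq_cdot orthonormal_basis_def)
    have "(\<Sum>l\<in>UNIV. (cmod (gft b (b k) l))\<^sup>2 * G l) = (\<Sum>l\<in>UNIV. if l = k then G l else 0)"
      by (intro sum.cong) (auto simp: coeff)
    moreover have "(norm (b k))\<^sup>2 = 1"
      by (simp add: gft_parseval[OF assms] coeff)
    ultimately show "\<alpha> \<le> G k \<and> G k \<le> \<beta>"
      using L[rule_format, of "b k"] by simp
  qed
next
  assume R: ?R
  \<comment> \<open>By Parseval all three quantities are sums over \<open>l\<close> with the same
    nonnegative weights \<open>(cmod (gft b f l))\<^sup>2\<close>, so they compare term by
    term.\<close>
  show ?L
    by (auto simp: gft_parseval[OF assms] sum_distrib_left R mult.commute[of \<alpha>]
        mult.commute[of \<beta>] intro!: sum_mono mult_left_mono)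
qed

theorem theorem5p2:
  fixes W :: "'n::finite \<Rightarrow> 'n \<Rightarrow> real"
    and A :: "complex ^ 'n ^ 'n"
    and lam :: "'n \<Rightarrow> complex"
    and b :: "'n \<Rightarrow> complex ^ 'n"
    and g :: "nat \<Rightarrow> complex ^ 'n"
    and M :: nat
    and \<alpha> \<beta> :: real
  assumes "connected_weighted_graph W"
    and "orthonormal_eigenbasis A lam b"
    and "0 < \<alpha>" and "0 < \<beta>"
  shows "is_frame (UNIV \<times> {1..M}) (\<lambda>(i, s). gtrans b i (g s)) \<alpha> \<beta> \<longleftrightarrow>
    (\<forall>l. \<alpha> / real CARD('n) \<le> (\<Sum>s=1..M. (cmod (gft b (g s) l))\<^sup>2) \<and>
         (\<Sum>s=1..M. (cmod (gft b (g s) l))\<^sup>2) \<le> \<beta> / real CARD('n))"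
proof -
  have onb: "orthonormal_basis b"
    using assms(2) by (simp add: orthonormal_eigenbasis_def)
  let ?G = "\<lambda>l. \<Sum>s=1..M. (cmod (gft b (g s) l))\<^sup>2"
  \<comment> \<open>The multiplier includes the factor \<open>CARD('n)\<close>; dividing by it
    afterwards yields the stated bounds.\<close>
  have "is_frame (UNIV \<times> {1..M}) (\<lambda>(i, s). gtrans b i (g s)) \<alpha> \<beta> \<longleftrightarrow>
      (\<forall>l. \<alpha> \<le> real CARD('n) * ?G l \<and> real CARD('n) * ?G l \<le> \<beta>)"
    using assms(3,4) multiplier_bounds_iff[OF onb, of \<alpha> "\<lambda>l. real CARD('n) * ?G l" \<beta>]
      frame_sum_gtrans[OF onb, of _ g "{1..M}"]
    by (simp add: is_frame_def case_prod_unfold)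
  also have "\<dots> \<longleftrightarrow> (\<forall>l. \<alpha> / real CARD('n) \<le> ?G l \<and> ?G l \<le> \<beta> / real CARD('n))"
    by (simp add: field_simps)
  finally show ?thesis .
qed

end
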